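(* Let $\mathcal D\subseteq(0,1)$ be nonempty and let $f:\mathcal D\to(0,1)$. Then there exists a finite automaton that simulates $f$ (i.e. for every $p\in\mathcal D$ it outputs an $f(p)$-coin from independent tosses of a $p$-coin) if and only if there is a rational function $F\in\mathbb Q(x)$ such that $F$ is defined and satisfies $0<F(x)<1$ for all $x\in(0,1)$, and $F(p)=f(p)$ for all $p\in\mathcal D$.
   Context: For a finite binary string $w\in\{0,1\}^*$ let $n_i(w)$ be the number of occurrences of the symbol $i$ in $w$, and for $p\in(0,1)$ set $\mathbf P_p[w]=p^{n_1(w)}(1-p)^{n_0(w)}$ and $\mathbf P_p[L]=\sum_{w\in L}\mathbf P_p[w]$ for a language $L\subseteq\{0,1\}^*$. A language is prefix-free if no string in it is a proper prefix of another string in it. For $\mathcal D\subseteq(0,1)$ and $f:\mathcal D\to[0,1]$, a simulation of $f$ is a pair of disjoint languages $L_0,L_1\subseteq\{0,1\}^*$ such that $L_0\cup L_1$ is prefix-free and, for every $p\in\mathcal D$, $\mathbf P_p[L_0\cup L_1]=1$ and $\mathbf P_p[L_1]=f(p)$. A finite automaton consists of a finite set of states $S$, a start state $s_0\in S$, a transition function $\delta:S\times\{0,1\}\to S$ (extended to strings by $\delta(s,w_1\cdots w_k)=\delta(\delta(s,w_1),w_2\cdots w_k)$), and two disjoint sets of final states $S_0,S_1\subseteq S$ which are absorbing ($\delta(s,b)=s$ for $s\in S_0\cup S_1$). Let $L_i$ be the set of strings $w$ such that $\delta(s_0,w)\in S_i$ but $\delta(s_0,w')\notin S_0\cup S_1$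 for every proper prefix $w'$ of $w$ (the automaton stops and outputs $i$). The automaton simulates $f$ if $(L_0,L_1)$ is a simulation of $f$. *)

theory Defs
  imports "HOL-Analysis.Analysis" "HOL-Computational_Algebra.Polynomial_Factorial"
begin

definition prob_word :: "real \<Rightarrow> bool list \<Rightarrow> real" where
  "prob_word p w = p ^ count_list w True * (1 - p) ^ count_list w False"

definition strict_prefix_of :: "bool list \<Rightarrow> bool list \<Rightarrow> bool" where
  "strict_prefix_of u v \<longleftrightarrow> (\<exists>z. z \<noteq> [] \<and> v = u @ z)"

definition prefix_free :: "bool list set \<Rightarrow> bool" where
  "prefix_free L \<longleftrightarrow> (\<forall>u\<in>L. \<forall>v\<in>L. \<not> strict_prefix_of u v)"

text \<open>P_p[L] = c is expressed as convergence of the (nonnegative) family over L to c.\<close>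
definition is_simulation ::
  "real set \<Rightarrow> (real \<Rightarrow> real) \<Rightarrow> bool list set \<Rightarrow> bool list set \<Rightarrow> bool" where
  "is_simulation D f L0 L1 \<longleftrightarrow>
     L0 \<inter> L1 = {} \<and> prefix_free (L0 \<union> L1) \<and>
     (\<forall>p\<in>D. (prob_word p has_sum 1) (L0 \<union> L1) \<and> (prob_word p has_sum f p) L1)"

definition fa_valid ::
  "nat set \<Rightarrow> nat \<Rightarrow> (nat \<Rightarrow> bool \<Rightarrow> nat) \<Rightarrow> nat set \<Rightarrow> nat set \<Rightarrow> bool" where
  "fa_valid S s0 \<delta> S0 S1 \<longleftrightarrow>
     finite S \<and> s0 \<in> S \<and> (\<forall>s\<in>S. \<forall>b. \<delta> s b \<in> S) \<and>
     S0 \<subseteq> S \<and> S1 \<subseteq> S \<and> S0 \<inter> S1 = {} \<and>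
     (\<forall>s\<in>S0 \<union> S1. \<forall>b. \<delta> s b = s)"

definition fa_run :: "(nat \<Rightarrow> bool \<Rightarrow> nat) \<Rightarrow> nat \<Rightarrow> bool list \<Rightarrow> nat" where
  "fa_run \<delta> s w = foldl \<delta> s w"

definition fa_lang ::
  "nat \<Rightarrow> (nat \<Rightarrow> bool \<Rightarrow> nat) \<Rightarrow> nat set \<Rightarrow> nat set \<Rightarrow> bool list set" where
  "fa_lang s0 \<delta> F Stop = {w. fa_run \<delta> s0 w \<in> F \<and>
       (\<forall>w'. strict_prefix_of w' w \<longrightarrow> fa_run \<delta> s0 w' \<notin> Stop)}"

definition fa_simulates ::
  "nat set \<Rightarrow> nat \<Rightarrow> (nat \<Rightarrow> bool \<Rightarrow> nat) \<Rightarrow> nat set \<Rightarrow> nat set \<Rightarrow>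
   real set \<Rightarrow> (real \<Rightarrow> real) \<Rightarrow> bool" where
  "fa_simulates S s0 \<delta> S0 S1 D f \<longleftrightarrow>
     fa_valid S s0 \<delta> S0 S1 \<and>
     is_simulation D f (fa_lang s0 \<delta> S0 (S0 \<union> S1)) (fa_lang s0 \<delta> S1 (S0 \<union> S1))"

end

theory Submission
  imports Defs "Jordan_Normal_Form.Determinant"
begin

text \<open>If an automaton simulates \<open>f\<close> at one \<open>p\<close>, every reachable state can still halt. The
  halting probabilities then solve a linear system over \<open>\<rat>[x]\<close> which is nonsingular for all
  \<open>x\<close> in the unit interval, so they are rational functions.

  Conversely, call a function simulable if it lies in a finite set \<open>H\<close> of functions in which each
  \<open>g\<close> other than 0 and 1 has the form \<open>g x = x * a x + (1 - x) * b x\<close> with \<open>a\<close>, \<open>b\<close> in \<open>H\<close>: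
  the functions themselves are the states (and a constant must be reachable from each). Simulable functions are closed under mixtures
  \<open>f * g + (1 - f) * k\<close> and, by looping until a decision is reached, under \<open>u / (u + v)\<close>. A
  positive polynomial has nonnegative rational coefficients in a Bernstein basis of high degree and
  hence is simulable up to a constant factor, which cancels in \<open>u / (u + v)\<close>.\<close>

subsection \<open>Halting probabilities\<close>

lemma prob_word_Nil [simp]: "prob_word x [] = 1"
  by (simp add: prob_word_def)

lemma prob_word_Cons [simp]:
  "prob_word x (b # w) = (if b then x else 1 - x) * prob_word x w"
  by (simp add: prob_word_def)

lemma prob_word_pos: "0 < x \<Longrightarrow> x < 1 \<Longrightarrow> 0 < prob_word x w"
  by (simp add: prob_word_def)

lemma strict_prefix_of_Nil [simp]: "\<not> strict_prefix_of u []"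
  by (simp add: strict_prefix_of_def)

lemma strict_prefix_of_Nil_left [simp]: "strict_prefix_of [] v \<longleftrightarrow> v \<noteq> []"
  by (simp add: strict_prefix_of_def)

lemma strict_prefix_of_Cons [simp]:
  "strict_prefix_of (a # u) (b # v) \<longleftrightarrow> a = b \<and> strict_prefix_of u v"
  by (auto simp: strict_prefix_of_def)

lemma strict_prefix_of_Cons_right:
  "strict_prefix_of u (b # v) \<longleftrightarrow> u = [] \<or> (\<exists>u'. u = b # u' \<and> strict_prefix_of u' v)"
  by (cases u) auto

text \<open>Kraft's inequality, by induction on a bound for the word lengths. Unless the empty word
  is the only member, deleting first letters splits \<open>L\<close> into two prefix-free sets,
  whose bounds are averaged with weights \<open>x\<close> and \<open>1 - x\<close>.\<close>

lemma kraft_finite: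
  assumes "finite L" "prefix_free L" "0 < x" "x < 1"
  shows "sum (prob_word x) L \<le> 1"
proof -
  have "\<forall>w\<in>L. length w \<le> n \<Longrightarrow> finite L \<Longrightarrow> prefix_free L \<Longrightarrow> sum (prob_word x) L \<le> 1" for n L
  proof (induction n arbitrary: L)
    case 0
    then have "L \<subseteq> {[]}" by auto
    then have "L = {} \<or> L = {[]}" by auto
    then show ?case by auto
  next
    case (Suc n)
    show ?case
    proof (cases "[] \<in> L")
      case True
      have "w = []" if "w \<in> L" for w
        using True that Suc.prems(3) unfolding prefix_free_def by (meson strict_prefix_of_Nil_left)
      then have "L = {[]}" using True by auto
      then show ?thesis by simp
    next
      case False
      let ?A = "\<lambda>b. {w. b # w \<in> L}"
      have fin: "finite (?A b)" for b
        using finite_vimageI[OF Suc.prems(2), of "Cons b"] by (simp add: vimage_def)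
      have le: "sum (prob_word x) (?A b) \<le> 1" for b
        using Suc.prems fin by (intro Suc.IH) (force simp: prefix_free_def)+
      have L: "L = Cons True ` ?A True \<union> Cons False ` ?A False"
      proof (intro equalityI subsetI)
        fix w assume "w \<in> L"
        then show "w \<in> Cons True ` ?A True \<union> Cons False ` ?A False"
          using False by (cases w; cases "hd w") auto
      qed auto
      have "sum (prob_word x) L = x * sum (prob_word x) (?A True) + (1 - x) * sum (prob_word x) (?A False)"
        by (subst L, subst sum.union_disjoint)
           (auto simp: fin sum.reindex sum_distrib_left)
      also have "\<dots> \<le> x * 1 + (1 - x) * 1"
        using assms le by (intro add_mono mult_left_mono) auto
      finally show ?thesis by simp
    qed
  qed
  moreover have "\<forall>w\<in>L. length w \<le> Max (length ` L)"
    using assms by auto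
  ultimately show ?thesis using assms by blast
qed

lemma
  assumes "prefix_free L" "0 < x" "x < 1"
  shows prob_word_summable: "prob_word x summable_on L"
    and kraft: "infsum (prob_word x) L \<le> 1"
proof -
  have fin: "sum (prob_word x) F \<le> 1" if "finite F" "F \<subseteq> L" for F
    using that assms by (intro kraft_finite) (auto simp: prefix_free_def)
  show "prob_word x summable_on L"
    using fin assms
    by (intro nonneg_bdd_above_summable_on bdd_aboveI2[where M = 1]) (auto simp: less_imp_le prob_word_pos)
  then show "infsum (prob_word x) L \<le> 1"
    using fin by (rule infsum_le_finite_sums)
qed

section \<open>Halting words of an automaton and their weights\<close>

lemma fa_run_Nil [simp]: "fa_run \<delta> s [] = s"
  and fa_run_Cons [simp]: "fa_run \<delta> s (b # w) = fa_run \<delta> (\<delta> s b) w"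
  and fa_run_append: "fa_run \<delta> s (u @ v) = fa_run \<delta> (fa_run \<delta> s u) v"
  by (simp_all add: fa_run_def)

lemma fa_lang_final:
  "s \<in> Stop \<Longrightarrow> fa_lang s \<delta> F Stop = (if s \<in> F then {[]} else {})"
  unfolding fa_lang_def by (auto simp: neq_Nil_conv) (metis fa_run_Nil list.exhaust strict_prefix_of_Nil_left)+

text \<open>Conditioning on the first toss; \<open>F \<subseteq> Stop\<close> keeps the empty word
  out of the left-hand side.\<close>

lemma fa_lang_step:
  assumes "s \<notin> Stop" "F \<subseteq> Stop"
  shows "fa_lang s \<delta> F Stop = Cons True ` fa_lang (\<delta> s True) \<delta> F Stop \<union> Cons False ` fa_lang (\<delta> s False) \<delta> F Stop"
proof (intro equalityI subsetI)
  fix w assume w: "w \<in> fa_lang s \<delta> F Stop"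
  then obtain b v where "w = b # v"
    using assms by (cases w) (auto simp: fa_lang_def)
  then show "w \<in> Cons True ` fa_lang (\<delta> s True) \<delta> F Stop \<union> Cons False ` fa_lang (\<delta> s False) \<delta> F Stop"
    using w by (cases b) (auto simp: fa_lang_def strict_prefix_of_Cons_right intro!: imageI)
qed (use assms in \<open>auto simp: fa_lang_def strict_prefix_of_Cons_right\<close>)

lemma prefix_free_fa_lang: "F \<subseteq> Stop \<Longrightarrow> prefix_free (fa_lang s \<delta> F Stop)"
  unfolding prefix_free_def fa_lang_def by blast

text \<open>\<open>infsum\<close> would default to 0 on a non-summable family; prefix-freeness rules
  this out when \<open>F \<subseteq> Stop\<close> and \<open>0 < x < 1\<close>.\<close>

definition halt_prob :: "(nat \<Rightarrow> bool \<Rightarrow> nat) \<Rightarrow> nat set \<Rightarrow> nat set \<Rightarrow> real \<Rightarrow> nat \<Rightarrow> real" where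
  "halt_prob \<delta> F Stop x s = infsum (prob_word x) (fa_lang s \<delta> F Stop)"

lemma has_sum_halt_prob:
  assumes "F \<subseteq> Stop" "0 < x" "x < 1"
  shows "(prob_word x has_sum halt_prob \<delta> F Stop x s) (fa_lang s \<delta> F Stop)"
  unfolding halt_prob_def
  by (intro has_sum_infsum prob_word_summable prefix_free_fa_lang assms)

lemma halt_prob_final:
  "s \<in> Stop \<Longrightarrow> halt_prob \<delta> F Stop x s = (if s \<in> F then 1 else 0)"
  by (simp add: halt_prob_def fa_lang_final)

text \<open>First-step analysis: the two halves of \<open>fa_lang_step\<close> are disjoint and
  carry the factors \<open>x\<close> and \<open>1 - x\<close>. Both directions of the theorem rest
  on this linear system.\<close>

lemma halt_prob_step:
  assumes "s \<notin> Stop" "F \<subseteq> Stop" "0 < x" "x < 1"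
  shows "halt_prob \<delta> F Stop x s = x * halt_prob \<delta> F Stop x (\<delta> s True) + (1 - x) * halt_prob \<delta> F Stop x (\<delta> s False)"
proof -
  have "(prob_word x has_sum ((if b then x else 1 - x) * halt_prob \<delta> F Stop x (\<delta> s b))) (Cons b ` fa_lang (\<delta> s b) \<delta> F Stop)" for b
    using has_sum_cmult_right[OF has_sum_halt_prob[OF assms(2-4), of "\<delta> s b" \<delta>], of "if b then x else 1 - x"]
    by (subst has_sum_reindex) (simp_all add: o_def)
  from has_sum_Un_disjoint[OF this[of True] this[of False]]
  have "(prob_word x has_sum (x * halt_prob \<delta> F Stop x (\<delta> s True) + (1 - x) * halt_prob \<delta> F Stop x (\<delta> s False)))
      (fa_lang s \<delta> F Stop)"
    by (subst fa_lang_step) (use assms in auto)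
  then show ?thesis
    using has_sum_halt_prob[OF assms(2-4)] has_sum_unique by blast
qed

lemma halt_prob_pos:
  assumes "F \<subseteq> Stop" "0 < x" "x < 1" "fa_lang s \<delta> F Stop \<noteq> {}"
  shows "0 < halt_prob \<delta> F Stop x s"
proof -
  obtain w where w: "w \<in> fa_lang s \<delta> F Stop" using assms by auto
  have "0 < prob_word x w" using assms by (simp add: prob_word_pos)
  also have "\<dots> = sum (prob_word x) {w}" by simp
  also have "\<dots> \<le> halt_prob \<delta> F Stop x s"
    using assms w by (intro finite_sum_le_has_sum[OF has_sum_halt_prob]) (auto simp: less_imp_le prob_word_pos)
  finally show ?thesis .
qed

lemma fa_lang_Un: "fa_lang s \<delta> (S0 \<union> S1) Stop = fa_lang s \<delta> S0 Stop \<union> fa_lang s \<delta> S1 Stop"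
  and fa_lang_disjoint: "S0 \<inter> S1 = {} \<Longrightarrow> fa_lang s \<delta> S0 Stop \<inter> fa_lang s \<delta> S1 Stop = {}"
  by (auto simp: fa_lang_def)

text \<open>The maximum principle: where \<open>\<bar>v\<bar>\<close> is maximal on \<open>R\<close>, it is maximal at both successors,
  hence along a path to \<open>Stop\<close>.\<close>

lemma harmonic_zero:
  fixes v :: "nat \<Rightarrow> real"
  assumes x: "0 < x" "x < 1"
    and "finite R" and closed: "\<And>s b. s \<in> R \<Longrightarrow> \<delta> s b \<in> R"
    and halts: "\<And>s. s \<in> R \<Longrightarrow> \<exists>w. fa_run \<delta> s w \<in> Stop"
    and final: "\<And>s. s \<in> R \<Longrightarrow> s \<in> Stop \<Longrightarrow> v s = 0"
    and step: "\<And>s. s \<in> R \<Longrightarrow> s \<notin> Stop \<Longrightarrow> v s = x * v (\<delta> s True) + (1 - x) * v (\<delta> s False)"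
    and "s \<in> R"
  shows "v s = 0"
proof -
  define M where "M = Max ((\<lambda>s. \<bar>v s\<bar>) ` R)"
  have le: "\<bar>v s\<bar> \<le> M" if "s \<in> R" for s
    unfolding M_def using that \<open>finite R\<close> by auto
  have "M \<in> (\<lambda>s. \<bar>v s\<bar>) ` R"
    unfolding M_def using \<open>finite R\<close> \<open>s \<in> R\<close> by (intro Max_in) auto
  then obtain t where t: "t \<in> R" "\<bar>v t\<bar> = M" by auto
  obtain w where "fa_run \<delta> t w \<in> Stop" using halts t by blast
  then have "M = 0" using t
  proof (induction w arbitrary: t)
    case Nil
    then show ?case using final by force
  next
    case (Cons b w)
    show ?case
    proof (cases "t \<in> Stop")
      case True
      then show ?thesis using final Cons.prems by force
    next
      case False
      let ?a = "\<bar>v (\<delta> t True)\<bar>" and ?b = "\<bar>v (\<delta> t False)\<bar>"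
      have ab: "?a \<le> M" "?b \<le> M" using le closed Cons.prems by auto
      have "M = \<bar>x * v (\<delta> t True) + (1 - x) * v (\<delta> t False)\<bar>"
        using step[OF Cons.prems(2) False] Cons.prems by simp
      also have "\<dots> \<le> x * ?a + (1 - x) * ?b"
        using abs_triangle_ineq[of "x * v (\<delta> t True)" "(1 - x) * v (\<delta> t False)"] x by (simp add: abs_mult)
      finally have "x * (M - ?a) + (1 - x) * (M - ?b) \<le> 0" by (simp add: algebra_simps)
      moreover have "0 \<le> x * (M - ?a)" "0 \<le> (1 - x) * (M - ?b)" using ab x by auto
      ultimately have "x * (M - ?a) = 0" "(1 - x) * (M - ?b) = 0" by linarith+
      then have "\<bar>v (\<delta> t b)\<bar> = M" using x by (cases b) auto
      then show ?thesis using Cons closed by auto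
    qed
  qed
  then show ?thesis using le[OF \<open>s \<in> R\<close>] by simp
qed

subsection \<open>Simulable functions\<close>

text \<open>Both parts of a splitting must lie in \<open>H\<close> because both become successor
  states, whereas one of them suffices as a path to \<open>c\<close>.\<close>

inductive reaches :: "(real \<Rightarrow> real) set \<Rightarrow> real \<Rightarrow> (real \<Rightarrow> real) \<Rightarrow> bool"
  for H :: "(real \<Rightarrow> real) set" and c :: real where
  base: "(\<And>x. 0 < x \<Longrightarrow> x < 1 \<Longrightarrow> g x = c) \<Longrightarrow> reaches H c g"
| step: "a \<in> H \<Longrightarrow> b \<in> H \<Longrightarrow> (\<And>x. 0 < x \<Longrightarrow> x < 1 \<Longrightarrow> g x = x * a x + (1 - x) * b x) \<Longrightarrow>
     reaches H c a \<or> reaches H c b \<Longrightarrow> reaches H c g"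

text \<open>Asking for both constants is what allows a loop to be left: a function that is not
  constantly 0 can reach output 1.\<close>

definition coin_system :: "(real \<Rightarrow> real) set \<Rightarrow> bool" where
  "coin_system H \<longleftrightarrow> finite H \<and>
     (\<forall>g\<in>H. ((\<forall>x. 0 < x \<and> x < 1 \<longrightarrow> g x = 0) \<or> reaches H 1 g) \<and>
            ((\<forall>x. 0 < x \<and> x < 1 \<longrightarrow> g x = 1) \<or> reaches H 0 g))"

definition simulable :: "(real \<Rightarrow> real) \<Rightarrow> bool" where
  "simulable f \<longleftrightarrow> (\<exists>H. coin_system H \<and> f \<in> H)"

lemma reaches_mono: "reaches H c g \<Longrightarrow> H \<subseteq> H' \<Longrightarrow> reaches H' c g"
proof (induction rule: reaches.induct)
  case (base g)
  then show ?case by (blast intro: reaches.base)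
next
  case (step a b g)
  then show ?case by (intro reaches.step[of a _ b]) auto
qed

lemma reaches_cong:
  assumes "reaches H c g" "\<And>x. 0 < x \<Longrightarrow> x < 1 \<Longrightarrow> g' x = g x"
  shows "reaches H c g'"
  using assms(1)
proof (cases rule: reaches.cases)
  case base
  then show ?thesis using assms(2) by (auto intro: reaches.base)
next
  case (step a b)
  then show ?thesis using assms(2) by (intro reaches.step[of a _ b]) auto
qed

text \<open>The mixture is affine in \<open>h\<close>, so every splitting of \<open>h\<close> splits
  the mixture and the path of \<open>h\<close> to \<open>d\<close> carries over. At its end the
  mixture is \<open>g\<close> for \<open>d = 1\<close> and \<open>k\<close> for
  \<open>d = 0\<close>.\<close>

lemma reaches_mix:
  assumes "reaches A d h" "\<And>a. a \<in> A \<Longrightarrow> (\<lambda>x. a x * g x + (1 - a x) * k x) \<in> H"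
    and t: "reaches H c (\<lambda>x. d * g x + (1 - d) * k x)"
  shows "reaches H c (\<lambda>x. h x * g x + (1 - h x) * k x)"
  using assms(1)
proof (induction rule: reaches.induct)
  case (base h)
  then show ?case by (intro reaches_cong[OF t]) auto
next
  case (step a b h)
  have "h x * g x + (1 - h x) * k x =
      x * (a x * g x + (1 - a x) * k x) + (1 - x) * (b x * g x + (1 - b x) * k x)" if "0 < x" "x < 1" for x
    by (simp only: step(3)[OF that]) (simp add: algebra_simps)
  then show ?case
    using step by (intro reaches.step[OF assms(2)[OF step(1)] assms(2)[OF step(2)]]) auto
qed

lemma simulable_cong:
  assumes "simulable f" "\<And>x. 0 < x \<Longrightarrow> x < 1 \<Longrightarrow> g x = f x"
  shows "simulable g"
proof -
  obtain H where H: "coin_system H" "f \<in> H" using assms by (auto simp: simulable_def)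
  have "coin_system (insert g H)"
    unfolding coin_system_def
  proof (intro conjI ballI)
    show "finite (insert g H)" using H by (simp add: coin_system_def)
  next
    fix h assume "h \<in> insert g H"
    then obtain h' where h': "h' \<in> H" "\<And>x. 0 < x \<Longrightarrow> x < 1 \<Longrightarrow> h x = h' x"
      using assms H by blast
    show "(\<forall>x. 0 < x \<and> x < 1 \<longrightarrow> h x = 0) \<or> reaches (insert g H) 1 h"
      using H(1) h' reaches_mono[of H 1 h' "insert g H"] reaches_cong[of _ _ h' h]
      unfolding coin_system_def by (metis subset_insertI)
    show "(\<forall>x. 0 < x \<and> x < 1 \<longrightarrow> h x = 1) \<or> reaches (insert g H) 0 h"
      using H(1) h' reaches_mono[of H 0 h' "insert g H"] reaches_cong[of _ _ h' h]
      unfolding coin_system_def by (metis subset_insertI)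
  qed
  then show ?thesis by (auto simp: simulable_def)
qed

lemma simulable_0: "simulable (\<lambda>x. 0)" and simulable_1: "simulable (\<lambda>x. 1)"
  unfolding simulable_def coin_system_def
  by (rule exI[of _ "{\<lambda>x. 0}"]; auto intro: reaches.base)
     (rule exI[of _ "{\<lambda>x. 1}"]; auto intro: reaches.base)

lemma simulable_id: "simulable (\<lambda>x. x)"
proof -
  let ?H = "{\<lambda>x. x, \<lambda>x. 1, \<lambda>x::real. 0::real}"
  have "reaches ?H c (\<lambda>x. x)" if "c = 0 \<or> c = 1" for c
    using that by (intro reaches.step[of "\<lambda>x. 1" _ "\<lambda>x. 0"]) (auto intro: reaches.base)
  then have "coin_system ?H"
    by (auto simp: coin_system_def intro: reaches.base)
  then show ?thesis by (auto simp: simulable_def)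
qed

text \<open>Run \<open>f\<close> first, then \<open>g\<close> after output 1 and \<open>k\<close>
  after output 0.\<close>

lemma simulable_mix:
  assumes "simulable f" "simulable g" "simulable k"
  shows "simulable (\<lambda>x. f x * g x + (1 - f x) * k x)"
proof -
  obtain F G K where F: "coin_system F" "f \<in> F" and G: "coin_system G" "g \<in> G"
    and K: "coin_system K" "k \<in> K"
    using assms by (auto simp: simulable_def)
  define mix where "mix h = (\<lambda>x. h x * g x + (1 - h x) * k x)" for h :: "real \<Rightarrow> real"
  define H where "H = mix ` F \<union> G \<union> K"
  have GK: "G \<subseteq> H" "K \<subseteq> H" by (auto simp: H_def)
  have mix1: "reaches H c (mix h)" if "reaches F 1 h" "reaches G c g" for c h
    unfolding mix_def
    by (rule reaches_mix[OF that(1)])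
       (use reaches_mono[OF that(2) GK(1)] in \<open>auto simp: H_def mix_def\<close>)
  have mix0: "reaches H c (mix h)" if "reaches F 0 h" "reaches K c k" for c h
    unfolding mix_def
    by (rule reaches_mix[OF that(1)])
       (use reaches_mono[OF that(2) GK(2)] in \<open>auto simp: H_def mix_def\<close>)
  have "coin_system H"
    unfolding coin_system_def
  proof (intro conjI ballI)
    show "finite H" using F G K by (auto simp: coin_system_def H_def)
  next
    fix m assume "m \<in> H"
    then consider h where "h \<in> F" "m = mix h" | "m \<in> G" | "m \<in> K" by (auto simp: H_def)
    note cases = this
    show "(\<forall>x. 0 < x \<and> x < 1 \<longrightarrow> m x = 0) \<or> reaches H 1 m"
    proof (cases rule: cases)
      case (1 h)
      have "(\<forall>x. 0 < x \<and> x < 1 \<longrightarrow> h x = 0) \<or> reaches F 1 h" "(\<forall>x. 0 < x \<and> x < 1 \<longrightarrow> h x = 1) \<or> reaches F 0 h"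
        "(\<forall>x. 0 < x \<and> x < 1 \<longrightarrow> g x = 0) \<or> reaches G 1 g" "(\<forall>x. 0 < x \<and> x < 1 \<longrightarrow> k x = 0) \<or> reaches K 1 k"
        using 1 F G K by (auto simp: coin_system_def)
      \<comment> \<open>If 1 is unreachable, both routes are blocked, through output 1 of
        \<open>h\<close> into \<open>g\<close> and through output 0 into \<open>k\<close>; hence
        both summands vanish.\<close>
      then have "reaches H 1 m \<or> (\<forall>x. 0 < x \<and> x < 1 \<longrightarrow> (h x = 0 \<or> g x = 0) \<and> (h x = 1 \<or> k x = 0))"
        unfolding 1(2) using mix1[of h 1] mix0[of h 1] by blast
      then show ?thesis by (auto simp: 1(2) mix_def)
    qed (use G K GK in \<open>auto simp: coin_system_def intro: reaches_mono\<close>)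
    show "(\<forall>x. 0 < x \<and> x < 1 \<longrightarrow> m x = 1) \<or> reaches H 0 m"
    proof (cases rule: cases)
      case (1 h)
      have "(\<forall>x. 0 < x \<and> x < 1 \<longrightarrow> h x = 0) \<or> reaches F 1 h" "(\<forall>x. 0 < x \<and> x < 1 \<longrightarrow> h x = 1) \<or> reaches F 0 h"
        "(\<forall>x. 0 < x \<and> x < 1 \<longrightarrow> g x = 1) \<or> reaches G 0 g" "(\<forall>x. 0 < x \<and> x < 1 \<longrightarrow> k x = 1) \<or> reaches K 0 k"
        using 1 F G K by (auto simp: coin_system_def)
      then have "reaches H 0 m \<or> (\<forall>x. 0 < x \<and> x < 1 \<longrightarrow> (h x = 0 \<or> g x = 1) \<and> (h x = 1 \<or> k x = 1))"
        unfolding 1(2) using mix1[of h 0] mix0[of h 0] by blast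
      then show ?thesis by (auto simp: 1(2) mix_def)
    qed (use G K GK in \<open>auto simp: coin_system_def intro: reaches_mono\<close>)
  qed
  moreover have "mix f \<in> H" using F by (auto simp: H_def)
  ultimately show ?thesis unfolding simulable_def mix_def by blast
qed

text \<open>The system of \<open>r\<close>: toss the coin, then run \<open>u\<close> (resp. \<open>v\<close>); if it
  outputs 1, stop with output 1 (resp. 0), otherwise start again.\<close>

lemma simulable_loop:
  assumes "simulable u" "simulable v"
    and u: "0 < y" "y < 1" "u y \<noteq> 0" and v: "0 < z" "z < 1" "v z \<noteq> 0"
    and r: "\<And>x. 0 < x \<Longrightarrow> x < 1 \<Longrightarrow> r x * (x * u x + (1 - x) * v x) = x * u x"
  shows "simulable r"
proof -
  obtain U V where U: "coin_system U" "u \<in> U" and V: "coin_system V" "v \<in> V"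
    using assms by (auto simp: simulable_def)
  \<comment> \<open>\<open>win h\<close> is the loop with \<open>u\<close> having arrived at
    \<open>h\<close>: output 1 ends the run with 1, output 0 returns to \<open>r\<close>.
    \<open>lose h\<close> plays the same part for \<open>v\<close>, ending with 0.\<close>
  define win where "win h = (\<lambda>x. h x * 1 + (1 - h x) * r x)" for h :: "real \<Rightarrow> real"
  define lose where "lose h = (\<lambda>x. h x * 0 + (1 - h x) * r x)" for h :: "real \<Rightarrow> real"
  define H where "H = insert r (win ` U \<union> lose ` V)"
  have win1: "reaches H 1 (win h)" if "reaches U 1 h" for h
    unfolding win_def
    by (rule reaches_mix[OF that]) (auto simp: H_def win_def intro: reaches.base)
  have lose1: "reaches H 0 (lose h)" if "reaches V 1 h" for h
    unfolding lose_def
    by (rule reaches_mix[OF that]) (auto simp: H_def lose_def intro: reaches.base)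
  have win0: "reaches H c (win h)" if "reaches U 0 h" "reaches H c r" for h c
    unfolding win_def
    by (rule reaches_mix[OF that(1)]) (use that(2) in \<open>auto simp: H_def win_def intro: reaches_cong\<close>)
  have lose0: "reaches H c (lose h)" if "reaches V 0 h" "reaches H c r" for h c
    unfolding lose_def
    by (rule reaches_mix[OF that(1)]) (use that(2) in \<open>auto simp: H_def lose_def intro: reaches_cong\<close>)
  \<comment> \<open>The hypothesis on \<open>r\<close>, rearranged, is the fixed point equation of
    the loop.\<close>
  have r_step: "r x = x * win u x + (1 - x) * lose v x" if "0 < x" "x < 1" for x
    using r[OF that] by (simp add: win_def lose_def algebra_simps)
  have in_H: "win u \<in> H" "lose v \<in> H" using U V by (auto simp: H_def)
  \<comment> \<open>The points \<open>y\<close> and \<open>z\<close> serve only to show that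
    \<open>u\<close> and \<open>v\<close> are not constantly 0, so that the loop can end with either
    output.\<close>
  have "reaches U 1 u" using U u by (auto simp: coin_system_def)
  then have r1: "reaches H 1 r"
    using in_H r_step win1 by (intro reaches.step[of "win u" _ "lose v"]) auto
  have "reaches V 1 v" using V v by (auto simp: coin_system_def)
  then have r0: "reaches H 0 r"
    using in_H r_step lose1 by (intro reaches.step[of "win u" _ "lose v"]) auto
  have "coin_system H"
    unfolding coin_system_def
  proof (intro conjI ballI)
    show "finite H" using U V by (auto simp: coin_system_def H_def)
  next
    fix m assume "m \<in> H"
    then consider "m = r" | h where "h \<in> U" "m = win h" | h where "h \<in> V" "m = lose h"
      by (auto simp: H_def)
    note cases = this
    show "(\<forall>x. 0 < x \<and> x < 1 \<longrightarrow> m x = 0) \<or> reaches H 1 m"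
    proof (cases rule: cases)
      case 1
      then show ?thesis using r1 by simp
    next
      case (2 h)
      show ?thesis
      proof (cases "reaches U 1 h")
        case False
        then have "\<forall>x. 0 < x \<and> x < 1 \<longrightarrow> h x = 0" using 2 U by (auto simp: coin_system_def)
        then show ?thesis using 2 by (auto simp: win_def intro: reaches_cong[OF r1])
      qed (use 2 win1 in auto)
    next
      case (3 h)
      show ?thesis
      proof (cases "reaches V 0 h")
        case False
        then have "\<forall>x. 0 < x \<and> x < 1 \<longrightarrow> h x = 1" using 3 V by (auto simp: coin_system_def)
        then show ?thesis using 3 by (auto simp: lose_def)
      qed (use 3 lose0 r1 in auto)
    qed
    show "(\<forall>x. 0 < x \<and> x < 1 \<longrightarrow> m x = 1) \<or> reaches H 0 m"
    proof (cases rule: cases)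
      case 1
      then show ?thesis using r0 by simp
    next
      case (2 h)
      show ?thesis
      proof (cases "reaches U 0 h")
        case False
        then have "\<forall>x. 0 < x \<and> x < 1 \<longrightarrow> h x = 1" using 2 U by (auto simp: coin_system_def)
        then show ?thesis using 2 by (auto simp: win_def)
      qed (use 2 win0 r0 in auto)
    next
      case (3 h)
      show ?thesis
      proof (cases "reaches V 1 h")
        case False
        then have "\<forall>x. 0 < x \<and> x < 1 \<longrightarrow> h x = 0" using 3 V by (auto simp: coin_system_def)
        then show ?thesis using 3 by (auto simp: lose_def intro: reaches_cong[OF r0])
      qed (use 3 lose1 in auto)
    qed
  qed
  then show ?thesis by (auto simp: simulable_def H_def)
qed

lemma simulable_mult: "simulable f \<Longrightarrow> simulable g \<Longrightarrow> simulable (\<lambda>x. f x * g x)"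
  using simulable_mix[of f g "\<lambda>x. 0"] simulable_0 by simp

lemma simulable_compl: "simulable f \<Longrightarrow> simulable (\<lambda>x. 1 - f x)"
  using simulable_mix[of f "\<lambda>x. 0" "\<lambda>x. 1"] simulable_0 simulable_1 by simp

text \<open>The factors \<open>1 - x\<close> and \<open>x\<close> cancel the bias of the coin tossed in the loop.\<close>

lemma simulable_ratio:
  assumes "simulable u" "simulable v" "\<And>x. 0 < x \<Longrightarrow> x < 1 \<Longrightarrow> 0 < u x"
    "\<And>x. 0 < x \<Longrightarrow> x < 1 \<Longrightarrow> 0 < v x"
  shows "simulable (\<lambda>x. u x / (u x + v x))"
proof (rule simulable_loop)
  show "simulable (\<lambda>x. (1 - x) * u x)" "simulable (\<lambda>x. x * v x)"
    using assms simulable_id simulable_mult simulable_compl by auto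
  show "(1 - 1/2) * u (1/2) \<noteq> 0" "1/2 * v (1/2) \<noteq> 0"
    using assms(3)[of "1/2"] assms(4)[of "1/2"] by auto
next
  fix x :: real assume "0 < x" "x < 1"
  moreover from this have "u x + v x \<noteq> 0" using assms(3)[of x] assms(4)[of x] by auto
  ultimately show "u x / (u x + v x) * (x * ((1 - x) * u x) + (1 - x) * (x * v x)) = x * ((1 - x) * u x)"
    by (simp add: divide_simps) (simp add: algebra_simps)
qed auto

lemma simulable_half: "simulable (\<lambda>x. 1 / 2)"
  using simulable_ratio[of "\<lambda>x. 1" "\<lambda>x. 1"] simulable_1 by simp

text \<open>The map \<open>t / (t + 1)\<close> turns each unit fraction into the next one.\<close>

lemma simulable_inverse_nat: "simulable (\<lambda>x. 1 / real (Suc n))"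
proof (induction n)
  case (Suc n)
  have "1 / real (Suc n) / (1 / real (Suc n) + 1) = 1 / real (Suc (Suc n))"
    by (simp add: divide_simps)
  then show ?case
    using simulable_ratio[OF Suc simulable_1] by (simp del: of_nat_Suc)
qed (use simulable_1 in simp)

section \<open>Simulability up to a constant factor\<close>

definition simulable_scaled :: "(real \<Rightarrow> real) \<Rightarrow> bool" where
  "simulable_scaled f \<longleftrightarrow> (\<exists>n. simulable (\<lambda>x. f x / real (Suc n)))"

lemma simulable_scaledI: "simulable f \<Longrightarrow> simulable_scaled f"
  unfolding simulable_scaled_def by (rule exI[of _ 0]) simp

lemma simulable_scaled_mult:
  assumes "simulable_scaled f" "simulable_scaled g"
  shows "simulable_scaled (\<lambda>x. f x * g x)"
proof -
  obtain m n where "simulable (\<lambda>x. f x / real (Suc m))" "simulable (\<lambda>x. g x / real (Suc n))"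
    using assms by (auto simp: simulable_scaled_def)
  from simulable_mult[OF this] have "simulable (\<lambda>x. f x * g x / real (Suc (m * n + m + n)))"
    by (rule simulable_cong) (simp add: algebra_simps)
  then show ?thesis unfolding simulable_scaled_def by blast
qed

text \<open>After passing to a common denominator, a fair coin chooses between the two functions;
  its factor 1/2 is absorbed into the scale.\<close>

lemma simulable_scaled_add:
  assumes "simulable_scaled f" "simulable_scaled g"
  shows "simulable_scaled (\<lambda>x. f x + g x)"
proof -
  obtain m n where "simulable (\<lambda>x. f x / real (Suc m))" "simulable (\<lambda>x. g x / real (Suc n))"
    using assms by (auto simp: simulable_scaled_def)
  then have "simulable (\<lambda>x. f x / real (Suc m) * (1 / real (Suc n)))"
    "simulable (\<lambda>x. g x / real (Suc n) * (1 / real (Suc m)))"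
    using simulable_mult simulable_inverse_nat by blast+
  from simulable_mix[OF simulable_half this]
  have "simulable (\<lambda>x. (f x + g x) / real (Suc (2 * (m * n + m + n) + 1)))"
  proof (rule simulable_cong)
    fix x
    have "real (Suc (2 * (m * n + m + n) + 1)) = 2 * real (Suc m) * real (Suc n)"
      by (simp add: algebra_simps)
    then show "(f x + g x) / real (Suc (2 * (m * n + m + n) + 1)) =
        1 / 2 * (f x / real (Suc m) * (1 / real (Suc n))) + (1 - 1 / 2) * (g x / real (Suc n) * (1 / real (Suc m)))"
      by (simp add: add_divide_distrib mult_ac del: of_nat_Suc)
  qed
  then show ?thesis unfolding simulable_scaled_def by blast
qed

lemma simulable_scaled_sum:
  "finite A \<Longrightarrow> (\<And>i. i \<in> A \<Longrightarrow> simulable_scaled (f i)) \<Longrightarrow> simulable_scaled (\<lambda>x. \<Sum>i\<in>A. f i x)"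
  by (induction A rule: finite_induct) (auto intro: simulable_scaled_add simulable_scaledI simulable_0)

lemma simulable_scaled_power: "simulable_scaled f \<Longrightarrow> simulable_scaled (\<lambda>x. f x ^ n)"
  by (induction n) (auto intro: simulable_scaled_mult simulable_scaledI simulable_1)

lemma simulable_scaled_of_nat: "simulable_scaled (\<lambda>x. real n)"
proof (induction n)
  case (Suc n)
  then show ?case using simulable_scaled_add[OF simulable_scaledI[OF simulable_1]] by fastforce
qed (simp add: simulable_scaledI simulable_0)

lemma simulable_scaled_of_rat:
  assumes "0 \<le> q" shows "simulable_scaled (\<lambda>x. of_rat q)"
proof -
  obtain a b where ab: "quotient_of q = (a, b)" by fastforce
  then have b: "b > 0" and q: "q = of_int a / of_int b"
    by (simp_all add: quotient_of_denom_pos quotient_of_div)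
  then have a: "a \<ge> 0" using assms by (auto simp: zero_le_divide_iff)
  obtain n where n: "nat b = Suc n" using b by (metis nat_eq_iff gr0_conv_Suc zero_less_nat_eq)
  have "simulable_scaled (\<lambda>x. real (nat a) * (1 / real (Suc n)))"
    by (intro simulable_scaled_mult simulable_scaled_of_nat simulable_scaledI simulable_inverse_nat)
  moreover have "real (nat a) * (1 / real (Suc n)) = of_rat q"
    using a b q n[symmetric] by (simp add: of_rat_divide del: of_nat_Suc)
  ultimately show ?thesis by simp
qed

text \<open>Both functions are brought to the same scale, which then cancels.\<close>

lemma simulable_scaled_ratio:
  assumes "simulable_scaled u" "simulable_scaled v" "\<And>x. 0 < x \<Longrightarrow> x < 1 \<Longrightarrow> 0 < u x"
    "\<And>x. 0 < x \<Longrightarrow> x < 1 \<Longrightarrow> 0 < v x"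
  shows "simulable (\<lambda>x. u x / (u x + v x))"
proof -
  obtain m n where mn: "simulable (\<lambda>x. u x / real (Suc m))" "simulable (\<lambda>x. v x / real (Suc n))"
    using assms by (auto simp: simulable_scaled_def)
  have "simulable (\<lambda>x. u x / real (Suc m) * (1 / real (Suc n)) / 
      (u x / real (Suc m) * (1 / real (Suc n)) + v x / real (Suc n) * (1 / real (Suc m))))"
    using mn assms(3,4) by (intro simulable_ratio simulable_mult simulable_inverse_nat) (auto simp del: of_nat_Suc)
  then show ?thesis
  proof (rule simulable_cong)
    fix x :: real assume "0 < x" "x < 1"
    then have "u x + v x > 0" using assms(3,4) by (simp add: add_pos_pos)
    moreover obtain N where "N \<noteq> 0" and N: "u x / real (Suc m) * (1 / real (Suc n)) = u x / N"
      "v x / real (Suc n) * (1 / real (Suc m)) = v x / N"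
      by (rule that[of "real (Suc m) * real (Suc n)"]) (auto simp del: of_nat_Suc)
    ultimately show "u x / (u x + v x) = u x / real (Suc m) * (1 / real (Suc n)) / 
      (u x / real (Suc m) * (1 / real (Suc n)) + v x / real (Suc n) * (1 / real (Suc m)))"
      unfolding N by (simp flip: add_divide_distrib)
  qed
qed

text \<open>The states are the functions of the system themselves. The transitions are chosen so that one
  successor is nearer to a constant, so that every state can halt.\<close>

lemma fa_simulates_of_simulable:
  assumes "simulable g" and D: "D \<subseteq> {0<..<1}" and fg: "\<And>p. p \<in> D \<Longrightarrow> f p = g p"
  shows "\<exists>S s0 \<delta> S0 S1. fa_simulates S s0 \<delta> S0 S1 D f"
proof -
  obtain H where H: "coin_system H" "g \<in> H" using assms by (auto simp: simulable_def)
  define const where "const c h \<longleftrightarrow> (\<forall>x. 0 < x \<and> x < 1 \<longrightarrow> h x = c)" for c :: real and h :: "real \<Rightarrow> real"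
  define split where "split h a b \<longleftrightarrow> (\<forall>x. 0 < x \<and> x < 1 \<longrightarrow> h x = x * a x + (1 - x) * b x)"
    for h a b :: "real \<Rightarrow> real"
  \<comment> \<open>\<open>lev n\<close> holds the members with a path of \<open>n\<close>
    splittings to the constant 0 or 1; \<open>rank\<close> is the length of a shortest such
    path.\<close>
  define lev where "lev = rec_nat {h\<in>H. const 0 h \<or> const 1 h} (\<lambda>n A. {h\<in>H. \<exists>a\<in>H. \<exists>b\<in>H. split h a b \<and> (a \<in> A \<or> b \<in> A)})"
  define rank where "rank h = (LEAST n. h \<in> lev n)" for h
  have "\<exists>n. h \<in> lev n" if "reaches H c h" "c = 0 \<or> c = 1" "h \<in> H" for h c
    using that
  proof (induction rule: reaches.induct)
    case (base h)
    then have "h \<in> lev 0" by (auto simp: lev_def const_def)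
    then show ?case ..
  next
    case (step a b h)
    then obtain n where "a \<in> lev n \<or> b \<in> lev n" by blast
    then have "h \<in> lev (Suc n)" using step by (auto simp: lev_def split_def)
    then show ?case ..
  qed
  \<comment> \<open>A member is constantly 0, hence in \<open>lev 0\<close>, or reaches 1; so every
    member has a level.\<close>
  moreover have "const 0 h \<or> reaches H 1 h" if "h \<in> H" for h
    using H that by (auto simp: coin_system_def const_def)
  moreover have "h \<in> lev 0" if "h \<in> H" "const 0 h" for h
    using that by (auto simp: lev_def)
  ultimately have lev: "h \<in> lev (rank h)" if "h \<in> H" for h
    unfolding rank_def using that by (metis LeastI_ex)
  have "\<exists>a b. a \<in> H \<and> b \<in> H \<and> split h a b \<and> (rank a < rank h \<or> rank b < rank h)"
    if h: "h \<in> H" "\<not> const 0 h" "\<not> const 1 h" for h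
  proof (cases "rank h")
    case 0
    then show ?thesis using lev[OF h(1)] h by (auto simp: lev_def)
  next
    case (Suc n)
    then obtain a b where "a \<in> H" "b \<in> H" "split h a b" "a \<in> lev n \<or> b \<in> lev n"
      using lev[OF h(1)] by (auto simp: lev_def)
    moreover have "rank a \<le> n" if "a \<in> lev n" for a
      unfolding rank_def using that by (rule Least_le)
    ultimately show ?thesis using Suc by (metis le_imp_less_Suc)
  qed
  then have "\<forall>h. \<exists>a b. h \<in> H \<and> \<not> const 0 h \<and> \<not> const 1 h \<longrightarrow>
      a \<in> H \<and> b \<in> H \<and> split h a b \<and> (rank a < rank h \<or> rank b < rank h)"
    by blast
  \<comment> \<open>One splitting per state is fixed, with a part of smaller rank. An arbitrary one
    would not do: splitting \<open>h\<close> into \<open>h\<close> and \<open>h\<close> never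
    halts.\<close>
  then obtain up down where "\<forall>h. h \<in> H \<and> \<not> const 0 h \<and> \<not> const 1 h \<longrightarrow>
      up h \<in> H \<and> down h \<in> H \<and> split h (up h) (down h) \<and> (rank (up h) < rank h \<or> rank (down h) < rank h)"
    unfolding choice_iff by blast
  then have nx: "up h \<in> H" "down h \<in> H" "split h (up h) (down h)"
      "rank (up h) < rank h \<or> rank (down h) < rank h"
    if "h \<in> H" "\<not> const 0 h" "\<not> const 1 h" for h
    using that by auto
  have "finite H" using H by (simp add: coin_system_def)
  \<comment> \<open>Automaton states are natural numbers, so the functions are numbered.\<close>
  then obtain e :: "(real \<Rightarrow> real) \<Rightarrow> nat" where e: "inj_on e H"
    using finite_imp_inj_to_nat_seg by blast
  define dec where "dec = inv_into H e"
  have dec [simp]: "dec (e h) = h" if "h \<in> H" for h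
    using that e by (simp add: dec_def)
  define S where "S = e ` H"
  define S0 where "S0 = e ` {h\<in>H. const 0 h}"
  define S1 where "S1 = e ` {h\<in>H. const 1 h}"
  have S0_iff: "e h \<in> S0 \<longleftrightarrow> const 0 h" and S1_iff: "e h \<in> S1 \<longleftrightarrow> const 1 h" if "h \<in> H" for h
    using that e by (auto simp: S0_def S1_def inj_on_eq_iff)
  define \<delta> where "\<delta> s b = (if s \<in> S0 \<union> S1 then s else e (if b then up (dec s) else down (dec s)))" for s b
  have "h (1/2) = c" if "const c h" for c h
    using that by (simp add: const_def)
  then have "\<not> (const 0 h \<and> const 1 h)" for h
    by (metis zero_neq_one)
  then have "S0 \<inter> S1 = {}"
    using S1_iff by (auto simp: S0_def)
  then have valid: "fa_valid S (e g) \<delta> S0 S1"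
    unfolding fa_valid_def using \<open>finite H\<close> H(2) nx(1,2) S0_iff S1_iff
    by (auto simp: S_def \<delta>_def) (auto simp: S0_def S1_def)
  have halts: "\<exists>w. fa_run \<delta> (e h) w \<in> S0 \<union> S1" if "h \<in> H" for h
    using that
  proof (induction "rank h" arbitrary: h rule: less_induct)
    case less
    show ?case
    proof (cases "const 0 h \<or> const 1 h")
      case True
      then have "fa_run \<delta> (e h) [] \<in> S0 \<union> S1" using S0_iff S1_iff less.prems by auto
      then show ?thesis ..
    next
      case False
      then have "rank (up h) < rank h \<or> rank (down h) < rank h" using nx(4)[OF less.prems] by simp
      then obtain b where "rank (if b then up h else down h) < rank h" by metis
      moreover have "\<delta> (e h) b = e (if b then up h else down h)" "(if b then up h else down h) \<in> H"
        using False less.prems S0_iff S1_iff nx(1,2) by (auto simp: \<delta>_def)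
      ultimately obtain w where "fa_run \<delta> (\<delta> (e h) b) w \<in> S0 \<union> S1" using less.hyps by metis
      then have "fa_run \<delta> (e h) (b # w) \<in> S0 \<union> S1" by simp
      then show ?thesis ..
    qed
  qed
  \<comment> \<open>Uniqueness: applied below to the difference of two solutions of the halting
    equations.\<close>
  have zero: "v (e g) = 0"
    if "0 < x" "x < 1" "\<And>s. s \<in> S \<Longrightarrow> s \<in> S0 \<union> S1 \<Longrightarrow> v s = 0"
      "\<And>s. s \<in> S \<Longrightarrow> s \<notin> S0 \<union> S1 \<Longrightarrow> v s = x * v (\<delta> s True) + (1 - x) * v (\<delta> s False)"
    for x :: real and v :: "nat \<Rightarrow> real"
  proof -
    have "finite S" using \<open>finite H\<close> by (simp add: S_def)
    moreover have closed: "\<delta> s b \<in> S" if "s \<in> S" for s b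
      using valid that by (auto simp: fa_valid_def)
    moreover have halts: "\<exists>w. fa_run \<delta> s w \<in> S0 \<union> S1" if "s \<in> S" for s
      using that halts by (auto simp: S_def)
    moreover have "e g \<in> S" using H by (simp add: S_def)
    ultimately show ?thesis
      using harmonic_zero[OF that(1,2) _ closed halts that(3,4)] by blast
  qed
  have "halt_prob \<delta> S1 (S0 \<union> S1) x (e g) = g x \<and> halt_prob \<delta> (S0 \<union> S1) (S0 \<union> S1) x (e g) = 1"
    if "0 < x" "x < 1" for x
  proof
    have fin: "dec s x = (if s \<in> S1 then 1 else 0)" if "s \<in> S0 \<union> S1" for s
      using that \<open>0 < x\<close> \<open>x < 1\<close> \<open>S0 \<inter> S1 = {}\<close> by (auto simp: S0_def S1_def const_def)
    have nonfin: "dec s x = x * dec (\<delta> s True) x + (1 - x) * dec (\<delta> s False) x"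
      if s: "s \<in> S" "s \<notin> S0 \<union> S1" for s
    proof -
      obtain h where h: "h \<in> H" "s = e h" "\<not> const 0 h" "\<not> const 1 h"
        using s S0_iff S1_iff by (auto simp: S_def)
      then show ?thesis
        using nx(1-3)[OF h(1,3,4)] s \<open>0 < x\<close> \<open>x < 1\<close> by (simp add: \<delta>_def split_def)
    qed
    \<comment> \<open>The functions attached to the states solve the equations for output 1, so the
      start state outputs 1 with probability \<open>g x\<close>.\<close>
    have "halt_prob \<delta> S1 (S0 \<union> S1) x (e g) - dec (e g) x = 0"
    proof (rule zero[OF that])
      fix s assume "s \<in> S" "s \<notin> S0 \<union> S1"
      from nonfin[OF this] halt_prob_step[OF this(2), of S1 x \<delta>] that
      show "halt_prob \<delta> S1 (S0 \<union> S1) x s - dec s x =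
          x * (halt_prob \<delta> S1 (S0 \<union> S1) x (\<delta> s True) - dec (\<delta> s True) x) +
          (1 - x) * (halt_prob \<delta> S1 (S0 \<union> S1) x (\<delta> s False) - dec (\<delta> s False) x)"
        by (simp add: algebra_simps)
    qed (simp only: halt_prob_final fin diff_self)
    then show "halt_prob \<delta> S1 (S0 \<union> S1) x (e g) = g x" using H by simp
    \<comment> \<open>The constant 1 solves the equations for halting at all, so the automaton halts
      almost surely.\<close>
    have "halt_prob \<delta> (S0 \<union> S1) (S0 \<union> S1) x (e g) - 1 = 0"
    proof (rule zero[OF that])
      fix s assume "s \<in> S" "s \<notin> S0 \<union> S1"
      from halt_prob_step[OF this(2), of "S0 \<union> S1" x \<delta>] that
      show "halt_prob \<delta> (S0 \<union> S1) (S0 \<union> S1) x s - 1 =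
          x * (halt_prob \<delta> (S0 \<union> S1) (S0 \<union> S1) x (\<delta> s True) - 1) +
          (1 - x) * (halt_prob \<delta> (S0 \<union> S1) (S0 \<union> S1) x (\<delta> s False) - 1)"
        by (simp add: algebra_simps)
    qed (simp add: halt_prob_final)
    then show "halt_prob \<delta> (S0 \<union> S1) (S0 \<union> S1) x (e g) = 1" by simp
  qed
  then have "is_simulation D f (fa_lang (e g) \<delta> S0 (S0 \<union> S1)) (fa_lang (e g) \<delta> S1 (S0 \<union> S1))"
    unfolding is_simulation_def fa_lang_Un[symmetric]
    using D fg \<open>S0 \<inter> S1 = {}\<close> has_sum_halt_prob[of "S0 \<union> S1" "S0 \<union> S1" _ "e g" \<delta>]
      has_sum_halt_prob[of S1 "S0 \<union> S1" _ "e g" \<delta>]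
    by (auto simp: fa_lang_disjoint prefix_free_fa_lang subset_iff)
  then show ?thesis using valid unfolding fa_simulates_def by blast
qed

subsection \<open>Positive polynomials\<close>

abbreviation rpoly :: "rat poly \<Rightarrow> real \<Rightarrow> real" where
  "rpoly R \<equiv> poly (map_poly of_rat R)"

lemma rpoly_eq_sum: "rpoly R x = (\<Sum>i\<le>degree R. of_rat (coeff R i) * x ^ i)"
  by (simp add: poly_altdef degree_map_poly coeff_map_poly)

lemma rpoly_pCons [simp]: "rpoly (pCons a R) x = of_rat a + x * rpoly R x"
  by (simp add: map_poly_pCons)

lemma rpoly_0 [simp]: "rpoly 0 x = 0" and rpoly_1 [simp]: "rpoly 1 x = 1"
  by simp_all

lemma rpoly_add [simp]: "rpoly (P + Q) x = rpoly P x + rpoly Q x"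
proof (induction P arbitrary: Q)
  case (pCons a P)
  show ?case
  proof (cases Q)
    case (pCons b Q')
    then show ?thesis by (simp add: of_rat_add pCons.IH distrib_left)
  qed
qed simp

lemma rpoly_smult [simp]: "rpoly (Polynomial.smult c P) x = of_rat c * rpoly P x"
  by (induction P) (auto simp: of_rat_mult algebra_simps)

lemma rpoly_mult [simp]: "rpoly (P * Q) x = rpoly P x * rpoly Q x"
  by (induction P) (auto simp: algebra_simps)

lemma rpoly_uminus [simp]: "rpoly (- P) x = - rpoly P x"
  using rpoly_add[of P "- P" x] by simp

lemma rpoly_diff [simp]: "rpoly (P - Q) x = rpoly P x - rpoly Q x"
  using rpoly_add[of P "- Q" x] by simp

lemma rpoly_of_rat: "rpoly R (of_rat c) = of_rat (poly R c)"
  by (induction R) (auto simp: of_rat_add of_rat_mult)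

text \<open>The Bernstein form of a monomial: expand \<open>x ^ i * (x + (1 - x)) ^ (n - i)\<close>
  by the binomial theorem and use \<open>(n choose k) * (k choose i) = (n choose i) * ((n - i)
  choose (k - i))\<close>.\<close>

lemma power_eq_bernstein_sum:
  fixes x :: real
  assumes "i \<le> n"
  shows "x ^ i = (\<Sum>k\<le>n. real (k choose i) / real (n choose i) * real (n choose k) * x ^ k * (1 - x) ^ (n - k))"
proof -
  have "real (k choose i) / real (n choose i) * real (n choose k) = real ((n - i) choose (k - i))"
    if "i \<le> k" "k \<le> n" for k
  proof -
    have "real (n choose k) * real (k choose i) = real (n choose i) * real ((n - i) choose (k - i))"
      using choose_mult[OF that] by (metis of_nat_mult)
    moreover have "real (n choose i) \<noteq> 0" using assms by simp
    ultimately show ?thesis by (simp add: field_simps)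
  qed
  then have "(\<Sum>k\<le>n. real (k choose i) / real (n choose i) * real (n choose k) * x ^ k * (1 - x) ^ (n - k)) =
      (\<Sum>k=i..n. real ((n - i) choose (k - i)) * x ^ k * (1 - x) ^ (n - k))"
    by (intro sum.mono_neutral_cong_right) (auto simp: binomial_eq_0)
  also have "\<dots> = (\<Sum>j\<le>n - i. real ((n - i) choose j) * x ^ (j + i) * (1 - x) ^ (n - i - j))"
    using assms by (intro sum.reindex_bij_witness[of _ "\<lambda>j. j + i" "\<lambda>k. k - i"]) auto
  also have "\<dots> = x ^ i * (\<Sum>j\<le>n - i. real ((n - i) choose j) * x ^ j * (1 - x) ^ (n - i - j))"
    by (simp add: sum_distrib_left power_add mult_ac)
  also have "\<dots> = x ^ i * (x + (1 - x)) ^ (n - i)"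
    by (subst binomial_ring) simp
  finally show ?thesis by simp
qed

text \<open>The quotient is a product of \<open>i\<close> factors, each close to
  \<open>k / n\<close>. All factors lie between 0 and 1, so the errors at most add up.\<close>

lemma binomial_ratio_near_power:
  assumes "k \<le> n" "2 * i \<le> n" "0 < n"
  shows "\<bar>real (k choose i) / real (n choose i) - (real k / real n) ^ i\<bar> \<le> real (2 * i * i) / real n"
proof -
  \<comment> \<open>The value 0 beyond \<open>k\<close> keeps the factors in the unit interval. If
    \<open>k < i\<close>, the factor \<open>c k = 0\<close> makes the product vanish, as
    \<open>k choose i\<close> does.\<close>
  define c where "c j = (if j \<le> k then (real k - real j) / (real n - real j) else 0)" for j
  have ratio: "real (k choose i) / real (n choose i) = (\<Prod>j<i. c j)"
  proof (cases "i \<le> k")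
    case True
    have ch: "real (m choose i) = (\<Prod>j<i. real m - real j) / fact i" if "i \<le> m" for m
      using binomial_gbinomial[of m i, where 'a = real]
      by (simp add: gbinomial_prod_rev atLeast0LessThan)
    have "real (k choose i) / real (n choose i) = (\<Prod>j<i. (real k - real j) / (real n - real j))"
      using True assms by (simp add: ch prod_dividef)
    also have "\<dots> = (\<Prod>j<i. c j)"
      using True by (intro prod.cong) (auto simp: c_def)
    finally show ?thesis .
  next
    case False
    moreover from this have "c k = 0" "k < i" by (auto simp: c_def)
    ultimately have "(\<Prod>j<i. c j) = 0" by (intro prod_zero) auto
    with False show ?thesis by (simp add: binomial_eq_0)
  qed
  have diff: "\<bar>c j - real k / real n\<bar> \<le> 2 * real i / real n" if "j < i" for j
  proof (cases "j \<le> k")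
    case True
    have pos: "real n - real j > 0" "real n > 0" using that assms by auto
    have "real k / real n - c j = real j * (real n - real k) / (real n * (real n - real j))"
      using True pos by (simp add: c_def field_simps)
    moreover have "real j * (real n - real k) / (real n * (real n - real j)) \<le> 2 * real i / real n"
    proof -
      have "real j * (real n - real k) \<le> real i * real n"
        using that assms by (intro mult_mono) auto
      \<comment> \<open>From \<open>j < i\<close> and \<open>2 * i \<le> n\<close>, the denominator
        \<open>n - j\<close> is at least half of \<open>n\<close>.\<close>
      also have "\<dots> \<le> real i * (2 * (real n - real j))"
        using that assms by (intro mult_left_mono) auto
      finally have "real j * (real n - real k) / (real n - real j) \<le> 2 * real i"
        using pos by (simp add: pos_divide_le_eq mult_ac)
      from divide_right_mono[OF this, of "real n"] show ?thesis by (simp add: mult.commute)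
    qed
    moreover have "real j * (real n - real k) / (real n * (real n - real j)) \<ge> 0"
      using pos assms by auto
    ultimately show ?thesis by linarith
  next
    case False
    then show ?thesis using that by (auto simp: c_def divide_right_mono)
  qed
  have "norm ((\<Prod>j<i. c j) - (\<Prod>j<i. real k / real n)) \<le> (\<Sum>j<i. norm (c j - real k / real n))"
    using assms by (intro norm_prod_diff) (auto simp: c_def divide_simps)
  also have "\<dots> \<le> (\<Sum>j<i. 2 * real i / real n)"
    using diff by (intro sum_mono) auto
  finally show ?thesis by (simp add: ratio mult_ac)
qed

text \<open>The Bernstein coefficients \<open>b k\<close> in degree \<open>n\<close> differ from the
  values of \<open>R\<close> at \<open>k / n\<close> by at most a constant over \<open>n\<close>.
  Since \<open>R\<close> has a positive minimum on the closed interval, they are nonnegative for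
  large \<open>n\<close>.\<close>

lemma simulable_scaled_positive_poly:
  assumes pos: "\<And>x. 0 \<le> x \<Longrightarrow> x \<le> 1 \<Longrightarrow> 0 < rpoly R x"
  shows "simulable_scaled (rpoly R)"
proof -
  let ?d = "degree R"
  have "continuous_on {0..1} (rpoly R)" by (intro continuous_intros)
  then obtain y where "y \<in> {0..1}" and y: "\<forall>x\<in>{0..1}. rpoly R y \<le> rpoly R x"
    using continuous_attains_inf[of "{0..1::real}" "rpoly R"] by (force simp del: atLeastAtMost_iff)
  then have "0 < rpoly R y" using pos by auto
  \<comment> \<open>\<open>B / n\<close> bounds the error of the coefficients; \<open>n\<close> is
    chosen to bring it down to the minimum \<open>rpoly R y\<close>.\<close>
  define B where "B = (\<Sum>i\<le>?d. \<bar>of_rat (coeff R i) :: real\<bar> * real (2 * i * i))"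
  obtain n where n: "2 * ?d \<le> n" "0 < n" "B \<le> real n * rpoly R y"
  proof -
    obtain m where "B < real m * rpoly R y"
      using reals_Archimedean3[OF \<open>0 < rpoly R y\<close>] by blast
    also have "\<dots> \<le> real (m + 2 * ?d + 1) * rpoly R y"
      using \<open>0 < rpoly R y\<close> by (intro mult_right_mono) auto
    finally show ?thesis by (intro that[of "m + 2 * ?d + 1"]) auto
  qed
  define b where "b k = (\<Sum>i\<le>?d. coeff R i * (of_nat (k choose i) / of_nat (n choose i)))" for k
  have b: "of_rat (b k) = (\<Sum>i\<le>?d. of_rat (coeff R i) * (real (k choose i) / real (n choose i)))" for k
    by (simp add: b_def of_rat_sum of_rat_mult of_rat_divide)
  have b_nonneg: "0 \<le> b k" if "k \<le> n" for k
  proof -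
    have "\<bar>of_rat (b k) - rpoly R (real k / real n)\<bar> =
        \<bar>\<Sum>i\<le>?d. of_rat (coeff R i) * (real (k choose i) / real (n choose i) - (real k / real n) ^ i)\<bar>"
      by (simp add: b rpoly_eq_sum sum_subtractf right_diff_distrib)
    also have "\<dots> \<le> (\<Sum>i\<le>?d. \<bar>of_rat (coeff R i)\<bar> * \<bar>real (k choose i) / real (n choose i) - (real k / real n) ^ i\<bar>)"
      by (rule order_trans[OF sum_abs]) (simp add: abs_mult)
    also have "\<dots> \<le> (\<Sum>i\<le>?d. \<bar>of_rat (coeff R i)\<bar> * (real (2 * i * i) / real n))"
      using n that by (intro sum_mono mult_left_mono binomial_ratio_near_power) auto
    also have "\<dots> = B / real n" by (simp add: B_def sum_divide_distrib)
    also have "\<dots> \<le> rpoly R y" using n by (simp add: field_simps)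
    also have "\<dots> \<le> rpoly R (real k / real n)" using y n that by auto
    finally have "0 \<le> (of_rat (b k) :: real)" by linarith
    then show ?thesis by simp
  qed
  have "rpoly R = (\<lambda>x. \<Sum>k\<le>n. of_rat (b k) * (real (n choose k) * (x ^ k * (1 - x) ^ (n - k))))"
  proof
    fix x
    have "rpoly R x = (\<Sum>i\<le>?d. of_rat (coeff R i) * 
        (\<Sum>k\<le>n. real (k choose i) / real (n choose i) * real (n choose k) * x ^ k * (1 - x) ^ (n - k)))"
      unfolding rpoly_eq_sum using n by (intro sum.cong arg_cong2[of _ _ _ _ times] power_eq_bernstein_sum) auto
    also have "\<dots> = (\<Sum>k\<le>n. \<Sum>i\<le>?d. of_rat (coeff R i) * 
        (real (k choose i) / real (n choose i) * real (n choose k) * x ^ k * (1 - x) ^ (n - k)))"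
      by (simp only: sum_distrib_left) (rule sum.swap)
    also have "\<dots> = (\<Sum>k\<le>n. of_rat (b k) * (real (n choose k) * (x ^ k * (1 - x) ^ (n - k))))"
      by (simp add: b sum_distrib_right mult.assoc)
    finally show "rpoly R x = \<dots>" .
  qed
  moreover have "simulable_scaled \<dots>"
    using b_nonneg
    by (intro simulable_scaled_sum simulable_scaled_mult simulable_scaled_of_rat simulable_scaled_of_nat
        simulable_scaled_power simulable_scaledI simulable_id simulable_compl) auto
  ultimately show ?thesis by simp
qed

lemma rpoly_factor_root:
  assumes "rpoly R (of_rat c) = 0"
  obtains R' where "R = [:- c, 1:] * R'"
  using assms by (auto simp: rpoly_of_rat poly_eq_0_iff_dvd elim: dvdE)

text \<open>In the closed interval only 0 and 1 can be roots. They are divided out by induction on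
  the degree, and the factors \<open>x\<close> and \<open>1 - x\<close> are simulable.\<close>

lemma simulable_scaled_poly:
  assumes pos: "\<And>x. 0 < x \<Longrightarrow> x < 1 \<Longrightarrow> 0 < rpoly R x"
  shows "simulable_scaled (rpoly R)"
  using pos
proof (induction "degree R" arbitrary: R rule: less_induct)
  case less
  have "R \<noteq> 0" using less.prems[of "1/2"] by auto
  have cont: "(rpoly R \<longlongrightarrow> rpoly R c) (at c within {0<..<1})" for c
    using poly_isCont[of c "map_poly of_rat R"] unfolding isCont_def by (rule tendsto_within_subset) auto
  \<comment> \<open>Continuity extends nonnegativity to the end points.\<close>
  have "0 \<le> rpoly R c" if "c = 0 \<or> c = 1" for c
  proof (rule tendsto_lowerbound[OF cont])
    show "at c within {0<..<1} \<noteq> bot" 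
      using that by (auto simp: trivial_limit_within islimpt_in_closure)
    show "\<forall>\<^sub>F x in at c within {0<..<1}. 0 \<le> rpoly R x"
      using less.prems by (auto simp: eventually_at_filter less_imp_le)
  qed
  then consider "rpoly R 0 = 0" | "rpoly R 1 = 0" | "0 < rpoly R 0" "0 < rpoly R 1"
    by force
  then show ?case
  proof cases
    case 1
    then obtain R' where R: "R = [:0, 1:] * R'" 
      using rpoly_factor_root[of R 0] by auto
    have "simulable_scaled (rpoly R')"
    proof (rule less.hyps)
      show "degree R' < degree R" using \<open>R \<noteq> 0\<close> unfolding R by (subst degree_mult_eq) auto
      show "0 < rpoly R' x" if "0 < x" "x < 1" for x
        using less.prems[OF that] that by (simp add: R zero_less_mult_iff)
    qed
    then have "simulable_scaled (\<lambda>x. x * rpoly R' x)"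
      using simulable_scaled_mult simulable_scaledI simulable_id by blast
    moreover have "rpoly R = (\<lambda>x. x * rpoly R' x)" by (simp add: R fun_eq_iff)
    ultimately show ?thesis by simp
  next
    case 2
    then obtain R'' where "R = [:- 1, 1:] * R''" 
      using rpoly_factor_root[of R 1] by auto
    \<comment> \<open>The sign is moved into the cofactor, so that the factor split off is
      \<open>1 - x\<close>.\<close>
    then obtain R' where R: "R = [:1, - 1:] * R'" 
      by (intro that[of "- R''"]) simp
    have "simulable_scaled (rpoly R')"
    proof (rule less.hyps)
      show "degree R' < degree R" using \<open>R \<noteq> 0\<close> unfolding R by (subst degree_mult_eq) auto
      show "0 < rpoly R' x" if "0 < x" "x < 1" for x
      proof -
        have "0 < (1 - x) * rpoly R' x" using less.prems[OF that] by (simp add: R algebra_simps)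
        then show ?thesis using that by (simp add: zero_less_mult_iff)
      qed
    qed
    then have "simulable_scaled (\<lambda>x. (1 - x) * rpoly R' x)"
      using simulable_scaled_mult simulable_scaledI simulable_compl simulable_id by blast
    moreover have "rpoly R = (\<lambda>x. (1 - x) * rpoly R' x)" by (simp add: R fun_eq_iff algebra_simps)
    ultimately show ?thesis by simp
  next
    case 3
    have "0 < rpoly R x" if "0 \<le> x" "x \<le> 1" for x
      using 3 less.prems[of x] that by (cases "x = 0"; cases "x = 1") auto
    then show ?thesis by (rule simulable_scaled_positive_poly)
  qed
qed

text \<open>Multiplying numerator and denominator by \<open>Q\<close> makes the denominator positive.\<close>

lemma simulable_rational:
  assumes "\<And>x. 0 < x \<Longrightarrow> x < 1 \<Longrightarrow> rpoly Q x \<noteq> 0 \<and> 0 < rpoly P x / rpoly Q x \<and> rpoly P x / rpoly Q x < 1"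
  shows "simulable (\<lambda>x. rpoly P x / rpoly Q x)"
proof -
  \<comment> \<open>As the quotient lies between 0 and 1, \<open>P\<close>, \<open>Q\<close> and
    \<open>Q - P\<close> all have the same sign at \<open>x\<close>.\<close>
  have pos: "0 < rpoly (P * Q) x \<and> 0 < rpoly (Q * (Q - P)) x" if "0 < x" "x < 1" for x
    using assms[OF that] by (auto simp: divide_simps zero_less_mult_iff split: if_splits)
  then have "simulable (\<lambda>x. rpoly (P * Q) x / (rpoly (P * Q) x + rpoly (Q * (Q - P)) x))"
    by (intro simulable_scaled_ratio simulable_scaled_poly) blast+
  then show ?thesis
  proof (rule simulable_cong)
    fix x :: real assume "0 < x" "x < 1"
    then have "rpoly Q x \<noteq> 0" using assms by blast
    moreover have "rpoly (P * Q) x + rpoly (Q * (Q - P)) x = rpoly Q x * rpoly Q x"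
      by (simp add: algebra_simps)
    ultimately show "rpoly P x / rpoly Q x = rpoly (P * Q) x / (rpoly (P * Q) x + rpoly (Q * (Q - P)) x)"
      by simp
  qed
qed

subsection \<open>Rationality of halting probabilities\<close>

text \<open>Evaluation at \<open>x\<close> therefore commutes with determinants.\<close>

lemma comm_ring_hom_rpoly: "comm_ring_hom (\<lambda>q. rpoly q x)"
  by unfold_locales auto

text \<open>Cramer's rule over \<open>\<rat>[x]\<close>: by the maximum principle the determinant of the system has no
  zero in the unit interval.\<close>

lemma halt_prob_rational:
  assumes "finite R" and closed: "\<And>s b. s \<in> R \<Longrightarrow> \<delta> s b \<in> R"
    and halts: "\<And>s. s \<in> R \<Longrightarrow> \<exists>w. fa_run \<delta> s w \<in> Stop"
    and "F \<subseteq> Stop" "s0 \<in> R"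
  obtains P Q where "\<And>x. 0 < x \<Longrightarrow> x < 1 \<Longrightarrow> rpoly Q x \<noteq> 0 \<and> halt_prob \<delta> F Stop x s0 = rpoly P x / rpoly Q x"
proof -
  obtain n where n: "\<And>s. s \<in> R \<Longrightarrow> s < n"
    using finite_nat_set_iff_bounded \<open>finite R\<close> by auto
  \<comment> \<open>Identity minus transition matrix. Final states and numbers outside
    \<open>R\<close> get identity rows; the two indicator terms are added because the successors may
    coincide.\<close>
  define entry :: "nat \<Rightarrow> nat \<Rightarrow> rat poly" where
    "entry i j = (if j = i then 1 else 0) - 
      (if i \<in> R - Stop then (if j = \<delta> i True then [:0, 1:] else 0) + (if j = \<delta> i False then [:1, -1:] else 0) else 0)" for i j
  define M where "M = Matrix.mat n n (\<lambda>(i, j). entry i j)"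
  define b where "b = Matrix.vec n (\<lambda>i. if i \<in> R \<inter> F then 1 else 0 :: rat poly)"
  have M: "M \<in> carrier_mat n n" and b: "b \<in> carrier_vec n" by (simp_all add: M_def b_def)
  define P where "P = Determinant.det (replace_col M b s0)"
  define Q where "Q = Determinant.det M"
  have "rpoly Q x \<noteq> 0 \<and> halt_prob \<delta> F Stop x s0 = rpoly P x / rpoly Q x" if x: "0 < x" "x < 1" for x
  proof -
    interpret comm_ring_hom "\<lambda>q. rpoly q x" by (rule comm_ring_hom_rpoly)
    let ?M = "map_mat (\<lambda>q. rpoly q x) M"
    have M': "?M \<in> carrier_mat n n" using M by simp
    have index: "Matrix.vec_index (mult_mat_vec ?M v) i = Matrix.vec_index v i -
        (if i \<in> R - Stop then x * Matrix.vec_index v (\<delta> i True) + (1 - x) * Matrix.vec_index v (\<delta> i False) else 0)"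
      if "v \<in> carrier_vec n" "i < n" for v i
    proof -
      have "Matrix.vec_index (mult_mat_vec ?M v) i = (\<Sum>j\<in>{0..<n}. rpoly (entry i j) x * Matrix.vec_index v j)"
        using that by (simp add: M_def scalar_prod_def)
      also have "\<dots> = (\<Sum>j\<in>{0..<n}. (if j = i then Matrix.vec_index v j else 0) -
          (if i \<in> R - Stop then (if j = \<delta> i True then x * Matrix.vec_index v j else 0) +
            (if j = \<delta> i False then (1 - x) * Matrix.vec_index v j else 0) else 0))"
        by (intro sum.cong refl) (auto simp: entry_def algebra_simps)
      also have "\<dots> = Matrix.vec_index v i -
        (if i \<in> R - Stop then x * Matrix.vec_index v (\<delta> i True) + (1 - x) * Matrix.vec_index v (\<delta> i False) else 0)"
        using that n[OF closed[of i]] by (auto simp: sum_subtractf sum.distrib)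
      finally show ?thesis .
    qed
    \<comment> \<open>A kernel vector vanishes outside \<open>R\<close> by the identity rows and on
      \<open>R\<close> by \<open>harmonic_zero\<close>.\<close>
    have "Determinant.det ?M \<noteq> 0"
    proof
      assume "Determinant.det ?M = 0"
      then obtain v where v: "v \<in> carrier_vec n" "v \<noteq> 0\<^sub>v n" "mult_mat_vec ?M v = 0\<^sub>v n"
        using det_0_iff_vec_prod_zero[OF M'] by blast
      have eq: "Matrix.vec_index v i = (if i \<in> R - Stop then
          x * Matrix.vec_index v (\<delta> i True) + (1 - x) * Matrix.vec_index v (\<delta> i False) else 0)" if "i < n" for i
        using index[OF v(1) that] v(3) that by simp
      have "Matrix.vec_index v i = 0" if "i < n" for i
      proof (cases "i \<in> R")
        case True
        then show ?thesis
          by (rule harmonic_zero[OF x \<open>finite R\<close> closed halts, rotated -1]) (use eq n in auto)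
      qed (use eq that in auto)
      then have "v = 0\<^sub>v n" using v(1) by (intro eq_vecI) auto
      then show False using v by simp
    qed
    \<comment> \<open>The value 0 outside \<open>R\<close> matches the identity rows, whose
      right-hand side is 0 there.\<close>
    define h where "h = Matrix.vec n (\<lambda>i. if i \<in> R then halt_prob \<delta> F Stop x i else 0)"
    have "mult_mat_vec ?M h = map_vec (\<lambda>q. rpoly q x) b"
    proof (rule eq_vecI)
      fix i assume "i < dim_vec (map_vec (\<lambda>q. rpoly q x) b)"
      then have "i < n" by (simp add: b_def)
      moreover have "h \<in> carrier_vec n" by (simp add: h_def)
      ultimately show "Matrix.vec_index (mult_mat_vec ?M h) i = Matrix.vec_index (map_vec (\<lambda>q. rpoly q x) b) i"
        using halt_prob_step[of i Stop F x \<delta>] halt_prob_final[of i Stop \<delta> F x] x \<open>F \<subseteq> Stop\<close> n closed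
        by (subst index) (auto simp: h_def b_def)
    qed (simp add: M_def b_def)
    then have "Determinant.det (replace_col ?M (map_vec (\<lambda>q. rpoly q x) b) s0) = Matrix.vec_index h s0 * Determinant.det ?M"
      using cramer_lemma_mat[OF M', of h s0] n \<open>s0 \<in> R\<close> by (simp add: h_def)
    \<comment> \<open>Cramer's rule is used at each \<open>x\<close> separately; column replacement
      commutes with evaluation, so the same \<open>P\<close> and \<open>Q\<close> serve for all
      \<open>x\<close>.\<close>
    moreover have "replace_col ?M (map_vec (\<lambda>q. rpoly q x) b) s0 = map_mat (\<lambda>q. rpoly q x) (replace_col M b s0)"
      using M b by (intro eq_matI) (auto simp: replace_col_def)
    ultimately have "rpoly P x = halt_prob \<delta> F Stop x s0 * rpoly Q x" "rpoly Q x \<noteq> 0"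
      using n \<open>s0 \<in> R\<close> \<open>Determinant.det ?M \<noteq> 0\<close> by (simp_all add: h_def P_def Q_def)
    then show ?thesis by simp
  qed
  then show ?thesis by (rule that)
qed

text \<open>A word \<open>u\<close> leading to a state that cannot halt could be added to the prefix-free language
  of all halting words, whose total weight is already 1.\<close>

lemma reachable_halts:
  assumes absorbing: "\<And>s b. s \<in> Stop \<Longrightarrow> \<delta> s b = s"
    and "0 < x" "x < 1" and total: "(prob_word x has_sum 1) (fa_lang s0 \<delta> Stop Stop)"
  shows "\<exists>w. fa_run \<delta> (fa_run \<delta> s0 u) w \<in> Stop"
proof (rule ccontr)
  assume no: "\<not> ?thesis"
  let ?L = "fa_lang s0 \<delta> Stop Stop"
  have stay: "fa_run \<delta> s w = s" if "s \<in> Stop" for s w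
    using that by (induction w) (auto simp: absorbing)
  have "fa_run \<delta> s0 u \<notin> Stop" using no by (metis fa_run_Nil)
  \<comment> \<open>A halting prefix of \<open>u\<close> would keep the run of \<open>u\<close> in
    \<open>Stop\<close>; a halting word extending \<open>u\<close> would let the state after
    \<open>u\<close> halt.\<close>
  then have "\<not> strict_prefix_of v u" if "v \<in> ?L" for v
    using that stay by (auto simp: fa_lang_def strict_prefix_of_def fa_run_append)
  moreover have "\<not> strict_prefix_of u v" if "v \<in> ?L" for v
    using that no by (auto simp: fa_lang_def strict_prefix_of_def fa_run_append)
  moreover have "\<not> strict_prefix_of u u"
    by (simp add: strict_prefix_of_def)
  ultimately have "prefix_free (insert u ?L)"
    using prefix_free_fa_lang[of Stop Stop s0 \<delta>] by (auto simp: prefix_free_def)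
  then have "infsum (prob_word x) (insert u ?L) \<le> 1" using assms by (intro kraft)
  moreover have "u \<notin> ?L" using \<open>fa_run \<delta> s0 u \<notin> Stop\<close> by (auto simp: fa_lang_def)
  then have "(prob_word x has_sum (prob_word x u + 1)) (insert u ?L)"
    by (intro has_sum_insert total)
  ultimately show False
    using prob_word_pos[of x u] assms infsumI by force
qed

text \<open>A single \<open>p\<close> in \<open>D\<close> shows that reachable states can halt and
  that both outputs occur. These facts do not mention the bias, so they yield rationality and the
  strict bounds on the whole open interval.\<close>

lemma rational_of_fa_simulates:
  assumes sim: "fa_simulates S s0 \<delta> S0 S1 D f" and D: "D \<subseteq> {0<..<1}"
    and p: "p \<in> D" "0 < f p" "f p < 1"
  obtains P Q :: "rat poly" where
    "\<And>x. 0 < x \<Longrightarrow> x < 1 \<Longrightarrow> rpoly Q x \<noteq> 0 \<and> 0 < rpoly P x / rpoly Q x \<and> rpoly P x / rpoly Q x < 1"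
    "\<And>x. x \<in> D \<Longrightarrow> rpoly P x / rpoly Q x = f x"
proof -
  let ?Stop = "S0 \<union> S1"
  define L where "L F = fa_lang s0 \<delta> F ?Stop" for F
  define h where "h F x = halt_prob \<delta> F ?Stop x s0" for F x
  have valid: "fa_valid S s0 \<delta> S0 S1" and disj: "S0 \<inter> S1 = {}"
    using sim by (auto simp: fa_simulates_def fa_valid_def)
  have sums: "(prob_word x has_sum 1) (L S0 \<union> L S1)" "(prob_word x has_sum f x) (L S1)" if "x \<in> D" for x
    using sim that by (auto simp: fa_simulates_def is_simulation_def L_def)
  have h: "(prob_word x has_sum h F x) (L F)" if "F \<subseteq> ?Stop" "0 < x" "x < 1" for F x
    unfolding h_def L_def by (rule has_sum_halt_prob[OF that])
  \<comment> \<open>The strict bounds on \<open>f p\<close> provide a word for each output.\<close>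
  have "L S1 \<noteq> {}"
    using sums(2)[OF p(1)] p(2) has_sum_unique[OF has_sum_empty] by fastforce
  moreover have "L S0 \<noteq> {}"
  proof
    assume "L S0 = {}"
    then have "(prob_word p has_sum 1) (L S1)" using sums(1)[OF p(1)] by simp
    from has_sum_unique[OF this sums(2)[OF p(1)]] p(3) show False by simp
  qed
  ultimately have nonempty: "L S0 \<noteq> {}" "L S1 \<noteq> {}" by auto
  \<comment> \<open>Halting is guaranteed only from reachable states, so the linear system is
    restricted to them.\<close>
  define R where "R = range (fa_run \<delta> s0)"
  have "fa_run \<delta> s w \<in> S" if "s \<in> S" for s w
    using that valid by (induction w arbitrary: s) (auto simp: fa_valid_def)
  then have "R \<subseteq> S" using valid by (auto simp: R_def fa_valid_def)
  have "\<exists>P Q. \<forall>x. 0 < x \<and> x < 1 \<longrightarrow> rpoly Q x \<noteq> 0 \<and> h S1 x = rpoly P x / rpoly Q x"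
  proof -
    have fin: "finite R" using valid \<open>R \<subseteq> S\<close> finite_subset by (auto simp: fa_valid_def)
    have "\<delta> (fa_run \<delta> s0 w) b = fa_run \<delta> s0 (w @ [b])" for w b
      by (simp add: fa_run_append)
    then have closed: "\<delta> s b \<in> R" if "s \<in> R" for s b
      using that unfolding R_def by blast
    have "0 < p" "p < 1" using p D by auto
    then have halts: "\<exists>w. fa_run \<delta> s w \<in> ?Stop" if "s \<in> R" for s
      using that valid sums[OF p(1)] reachable_halts[of ?Stop \<delta> p s0]
      by (auto simp: R_def fa_valid_def L_def fa_lang_Un)
    have "s0 \<in> R" unfolding R_def by (metis fa_run_Nil rangeI)
    from halt_prob_rational[OF fin closed halts _ this, of S1] show ?thesis
      unfolding h_def by (metis Un_upper2)
  qed
  then obtain P Q where PQ: "\<And>x. 0 < x \<Longrightarrow> x < 1 \<Longrightarrow> rpoly Q x \<noteq> 0 \<and> h S1 x = rpoly P x / rpoly Q x"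
    by blast
  show ?thesis
  proof (rule that)
    fix x :: real assume x: "0 < x" "x < 1"
    have "0 < h S0 x" "0 < h S1 x"
      using x nonempty unfolding h_def L_def by (auto intro: halt_prob_pos)
    moreover have "(prob_word x has_sum (h S0 x + h S1 x)) (L ?Stop)"
      unfolding L_def fa_lang_Un using h[of S0 x] h[of S1 x] x disj
      by (intro has_sum_Un_disjoint) (auto simp: L_def fa_lang_disjoint)
    \<comment> \<open>Kraft's inequality together with \<open>0 < h S0 x\<close> keeps
      \<open>h S1 x\<close> below 1, also outside \<open>D\<close>.\<close>
    then have "h S0 x + h S1 x \<le> 1"
      using kraft[of "L ?Stop" x] x prefix_free_fa_lang[of ?Stop ?Stop s0 \<delta>] by (simp add: infsumI L_def)
    ultimately show "rpoly Q x \<noteq> 0 \<and> 0 < rpoly P x / rpoly Q x \<and> rpoly P x / rpoly Q x < 1"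
      using PQ[OF x] by simp
  next
    fix x assume "x \<in> D"
    then have "0 < x" "x < 1" using D by auto
    with PQ[OF this] h[of S1 x] sums(2)[OF \<open>x \<in> D\<close>] has_sum_unique
    show "rpoly P x / rpoly Q x = f x" by (metis Un_upper2)
  qed
qed

text \<open>Common divisors are removed by induction on the degree of the denominator. A divisor of
  \<open>Q\<close> has no zero where \<open>Q\<close> has none, so values there are
  unchanged.\<close>

lemma rational_coprime:
  fixes P Q :: "rat poly"
  assumes "Q \<noteq> 0"
  shows "\<exists>P' Q'. coprime P' Q' \<and> Q' \<noteq> 0 \<and>
    (\<forall>x. rpoly Q x \<noteq> 0 \<longrightarrow> rpoly Q' x \<noteq> 0 \<and> rpoly P' x / rpoly Q' x = rpoly P x / rpoly Q x)"
  using assms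
proof (induction "degree Q" arbitrary: P Q rule: less_induct)
  case less
  show ?case
  proof (cases "coprime P Q")
    case True
    then show ?thesis using less.prems by blast
  next
    case False
    then obtain c where c: "c dvd P" "c dvd Q" "\<not> is_unit c" unfolding coprime_def by blast
    then obtain P1 Q1 where PQ: "P = c * P1" "Q = c * Q1" by (auto elim!: dvdE)
    then have nz: "c \<noteq> 0" "Q1 \<noteq> 0" using less.prems by auto
    then have "degree Q1 < degree Q" using c(3) by (simp add: PQ degree_mult_eq is_unit_iff_degree)
    from less.hyps[OF this nz(2), of P1] show ?thesis by (simp add: PQ) (metis mult_divide_mult_cancel_left)
  qed
qed

theorem theorem1:
  fixes D :: "real set" and f :: "real \<Rightarrow> real"
  assumes "D \<subseteq> {0<..<1}" and "D \<noteq> {}"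
    and "\<forall>p\<in>D. 0 < f p \<and> f p < 1"
  shows "(\<exists>S s0 \<delta> S0 S1. fa_simulates S s0 \<delta> S0 S1 D f) \<longleftrightarrow>
    (\<exists>P Q :: rat poly. Q \<noteq> 0 \<and> coprime P Q \<and>
       (\<forall>x::real. 0 < x \<and> x < 1 \<longrightarrow>
          poly (map_poly of_rat Q) x \<noteq> 0 \<and>
          0 < poly (map_poly of_rat P) x / poly (map_poly of_rat Q) x \<and>
          poly (map_poly of_rat P) x / poly (map_poly of_rat Q) x < 1) \<and>
       (\<forall>p\<in>D. poly (map_poly of_rat P) p / poly (map_poly of_rat Q) p = f p))"
proof
  assume "\<exists>S s0 \<delta> S0 S1. fa_simulates S s0 \<delta> S0 S1 D f"
  then obtain S s0 \<delta> S0 S1 where sim: "fa_simulates S s0 \<delta> S0 S1 D f" by blast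
  obtain p where p: "p \<in> D" "0 < f p" "f p < 1" using assms by blast
  obtain P Q :: "rat poly" where
    unit: "\<And>x. 0 < x \<Longrightarrow> x < 1 \<Longrightarrow> rpoly Q x \<noteq> 0 \<and> 0 < rpoly P x / rpoly Q x \<and> rpoly P x / rpoly Q x < 1"
    and D: "\<And>x. x \<in> D \<Longrightarrow> rpoly P x / rpoly Q x = f x"
    by (rule rational_of_fa_simulates[OF sim assms(1) p]) blast
  have "Q \<noteq> 0" using unit[of "1/2"] by auto
  from rational_coprime[OF this, of P] obtain P' Q' where "coprime P' Q'" "Q' \<noteq> 0" and
    eq: "\<And>x. rpoly Q x \<noteq> 0 \<Longrightarrow> rpoly Q' x \<noteq> 0 \<and> rpoly P' x / rpoly Q' x = rpoly P x / rpoly Q x"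
    by blast
  moreover have "rpoly Q' x \<noteq> 0 \<and> 0 < rpoly P' x / rpoly Q' x \<and> rpoly P' x / rpoly Q' x < 1"
    if "0 < x" "x < 1" for x
    using unit[OF that] eq by metis
  moreover have "rpoly P' x / rpoly Q' x = f x" if "x \<in> D" for x
    using D[OF that] unit[of x] eq[of x] assms(1) that by fastforce
  ultimately show "\<exists>P Q. Q \<noteq> 0 \<and> coprime P Q \<and>
       (\<forall>x. 0 < x \<and> x < 1 \<longrightarrow> rpoly Q x \<noteq> 0 \<and> 0 < rpoly P x / rpoly Q x \<and> rpoly P x / rpoly Q x < 1) \<and>
       (\<forall>p\<in>D. rpoly P p / rpoly Q p = f p)"
    by blast
next
  assume "\<exists>P Q. Q \<noteq> 0 \<and> coprime P Q \<and>
       (\<forall>x. 0 < x \<and> x < 1 \<longrightarrow> rpoly Q x \<noteq> 0 \<and> 0 < rpoly P x / rpoly Q x \<and> rpoly P x / rpoly Q x < 1) \<and>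
       (\<forall>p\<in>D. rpoly P p / rpoly Q p = f p)"
  then obtain P Q where PQ: "\<And>x. 0 < x \<Longrightarrow> x < 1 \<Longrightarrow>
      rpoly Q x \<noteq> 0 \<and> 0 < rpoly P x / rpoly Q x \<and> rpoly P x / rpoly Q x < 1"
    and D: "\<And>p. p \<in> D \<Longrightarrow> f p = rpoly P p / rpoly Q p"
    by metis
  from fa_simulates_of_simulable[OF simulable_rational[OF PQ] assms(1) D]
  show "\<exists>S s0 \<delta> S0 S1. fa_simulates S s0 \<delta> S0 S1 D f" .
qed

end
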